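(* Let $\Omega=[-1,1]^2$. The eigenvalue problem $$\Delta^2 u=\mu u\ \text{ in }\Omega,\qquad u=0\ \text{ and }\ \partial_\nu u=0\ \text{ on }\partial\Omega$$ does not have any separable solutions; that is, for no $\mu\in\mathbb{R}$ does there exist a solution $u\not\equiv 0$ of the form $u(x,y)=\alpha(x)\beta(y)$.
   Context: All functions are real-valued. $\Delta=\partial_x^2+\partial_y^2$, $\Delta^2=\partial_x^4+2\partial_x^2\partial_y^2+\partial_y^4$, and $\partial_\nu$ denotes the derivative in the direction of the exterior unit normal $\nu$ on the edges of the square (away from the corners). The PDE holds in the interior of the square. Solutions are understood classically: $u$ is $C^4$ in the interior of $\Omega$ and $C^1$ on the closed square. *)

theory Defs
  imports "HOL-Analysis.Analysis"
begin

definition square :: "(real \<times> real) set" where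
  "square = {-1..1} \<times> {-1..1}"

text \<open>
  Continuous differentiability of order \<open>k\<close> on a set \<open>S\<close> that is open or is the closed square.
  Derivatives are taken within \<open>S\<close>, so they are one-sided at boundary points belonging
  to \<open>S\<close>. For such \<open>S\<close> the functions \<open>ux\<close> and \<open>uy\<close> are uniquely determined on \<open>S\<close>: they are
  the two first-order partial derivatives of \<open>u\<close>.
\<close>

fun Ck_on :: "nat \<Rightarrow> (real \<times> real) set \<Rightarrow> (real \<times> real \<Rightarrow> real) \<Rightarrow> bool" where
  "Ck_on 0 S u \<longleftrightarrow> continuous_on S u"
| "Ck_on (Suc k) S u \<longleftrightarrow>
     (\<exists>ux uy. Ck_on k S ux \<and> Ck_on k S uy \<and>
       (\<forall>p\<in>S. (u has_derivative (\<lambda>h. ux p * fst h + uy p * snd h)) (at p within S)))"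

definition partial_x :: "(real \<times> real \<Rightarrow> real) \<Rightarrow> real \<times> real \<Rightarrow> real" where
  "partial_x u p = deriv (\<lambda>s. u (s, snd p)) (fst p)"

definition partial_y :: "(real \<times> real \<Rightarrow> real) \<Rightarrow> real \<times> real \<Rightarrow> real" where
  "partial_y u p = deriv (\<lambda>t. u (fst p, t)) (snd p)"

definition bilaplacian :: "(real \<times> real \<Rightarrow> real) \<Rightarrow> real \<times> real \<Rightarrow> real" where
  "bilaplacian u p =
     (partial_x ^^ 4) u p + 2 * (partial_x ^^ 2) ((partial_y ^^ 2) u) p + (partial_y ^^ 4) u p"

text \<open>\<open>\<nu>\<close> is the exterior unit normal at the point \<open>p\<close> of an open edge; corners have none.\<close>

definition exterior_unit_normal :: "real \<times> real \<Rightarrow> real \<times> real \<Rightarrow> bool" where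
  "exterior_unit_normal p \<nu> \<longleftrightarrow>
     (\<exists>s\<in>{-1<..<1}.
        p = (1, s) \<and> \<nu> = (1, 0) \<or> p = (-1, s) \<and> \<nu> = (-1, 0) \<or>
        p = (s, 1) \<and> \<nu> = (0, 1) \<or> p = (s, -1) \<and> \<nu> = (0, -1))"

text \<open>
  The derivative at \<open>p\<close> in direction \<open>\<nu>\<close>; as \<open>\<nu>\<close> points out of the domain, the
  difference quotient only uses the points \<open>p + t \<nu>\<close> with \<open>t \<le> 0\<close>.
\<close>

definition has_normal_derivative ::
  "(real \<times> real \<Rightarrow> real) \<Rightarrow> real \<Rightarrow> real \<times> real \<Rightarrow> real \<times> real \<Rightarrow> bool" where
  "has_normal_derivative u d p \<nu> \<longleftrightarrow>
     ((\<lambda>t. u (p + t *\<^sub>R \<nu>)) has_real_derivative d) (at 0 within {..0})"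

definition clamped_plate_solution :: "real \<Rightarrow> (real \<times> real \<Rightarrow> real) \<Rightarrow> bool" where
  "clamped_plate_solution \<mu> u \<longleftrightarrow>
     Ck_on 4 (interior square) u \<and> Ck_on 1 square u \<and>
     (\<forall>p\<in>interior square. bilaplacian u p = \<mu> * u p) \<and>
     (\<forall>p\<in>frontier square. u p = 0) \<and>
     (\<forall>p \<nu>. exterior_unit_normal p \<nu> \<longrightarrow> has_normal_derivative u 0 p \<nu>)"

definition separable_on_square :: "(real \<times> real \<Rightarrow> real) \<Rightarrow> bool" where
  "separable_on_square u \<longleftrightarrow>
     (\<exists>\<alpha> \<beta> :: real \<Rightarrow> real. \<forall>x\<in>{-1..1}. \<forall>y\<in>{-1..1}. u (x, y) = \<alpha> x * \<beta> y)"

end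

theory Submission
  imports Defs
begin

text \<open>
  Take for \<open>f\<close> and \<open>g\<close> slices of \<open>u\<close> through a point where \<open>u\<close> does not vanish, so that
  \<open>f'''' g + 2 f'' g'' + f g'''' = \<mu> f g\<close>. If \<open>f''\<close> is not a constant multiple of \<open>f\<close>, comparing
  this equation at two values of \<open>x\<close> eliminates \<open>g''''\<close> and leaves \<open>g'' = c g\<close>. So one of the
  factors solves a second-order linear equation; having zero value and zero derivative at the
  endpoint \<open>1\<close>, it vanishes identically.
\<close>

section \<open>Uniqueness for second-order linear equations\<close>

lemma linear_second_order_zero:
  fixes f D :: "real \<Rightarrow> real"
  assumes cf: "continuous_on {a..b} f" and cD: "continuous_on {a..b} D"
    and f: "\<And>x. a < x \<Longrightarrow> x < b \<Longrightarrow> (f has_real_derivative D x) (at x)"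
    and D: "\<And>x. a < x \<Longrightarrow> x < b \<Longrightarrow> (D has_real_derivative c * f x) (at x)"
    and fb: "f b = 0" and Db: "D b = 0" and x: "x \<in> {a..b}"
  shows "f x = 0"
proof -
  \<comment> \<open>Weighted energy argument run backwards from \<open>b\<close>. The derivative of
    \<open>(f t)\<^sup>2 + (D t)\<^sup>2\<close> is \<open>2 * (1 + c) * (f t * D t)\<close>, which
    is at least \<open>- K\<close> times the energy, so the factor \<open>exp (K * t)\<close> makes
    \<open>E\<close> nondecreasing. Since \<open>E b = 0\<close> and \<open>E\<close> is
    nonnegative, \<open>E x\<close> vanishes. Derivatives are needed only in the open interval;
    continuity covers the endpoints.\<close>
  define K where "K = 1 + \<bar>c\<bar>"
  define E where "E = (\<lambda>t. ((f t)\<^sup>2 + (D t)\<^sup>2) * exp (K * t))"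
  have "E x \<le> E b"
  proof (rule DERIV_nonneg_imp_increasing_open[where f = E])
    show "x \<le> b" using x by simp
    have "continuous_on {a..b} E"
      unfolding E_def by (intro continuous_intros cf cD)
    then show "continuous_on {x..b} E"
      using x by (rule_tac continuous_on_subset) auto
    fix t assume "x < t" "t < b"
    then have t: "a < t" "t < b" using x by auto
    let ?E' = "(2 * (1 + c) * (f t * D t) + K * ((f t)\<^sup>2 + (D t)\<^sup>2)) * exp (K * t)"
    have "(E has_real_derivative ?E') (at t)"
      unfolding E_def
      by (rule derivative_eq_intros f D t refl)+ (simp add: algebra_simps power2_eq_square)
    moreover have "?E' \<ge> 0"
    proof -
      have "\<bar>2 * (f t * D t)\<bar> \<le> (f t)\<^sup>2 + (D t)\<^sup>2"
        using sum_squares_bound[of "f t" "D t"] sum_squares_bound[of "f t" "- D t"]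
        by (simp add: abs_if mult.assoc)
      moreover have "\<bar>1 + c\<bar> \<le> K" by (simp add: K_def)
      ultimately have "\<bar>1 + c\<bar> * \<bar>2 * (f t * D t)\<bar> \<le> K * ((f t)\<^sup>2 + (D t)\<^sup>2)"
        by (intro mult_mono) (auto simp: K_def)
      then have "\<bar>2 * (1 + c) * (f t * D t)\<bar> \<le> K * ((f t)\<^sup>2 + (D t)\<^sup>2)"
        unfolding abs_mult by (simp only: mult_ac)
      then show ?thesis by simp
    qed
    ultimately show "\<exists>y. (E has_real_derivative y) (at t) \<and> y \<ge> 0" by blast
  qed
  then have "(f x)\<^sup>2 + (D x)\<^sup>2 \<le> 0"
    by (simp add: E_def fb Db mult_le_0_iff)
  then show ?thesis
    by (simp add: sum_power2_le_zero_iff)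
qed

section \<open>Iterated derivatives in one variable\<close>

lemma funpow_deriv_cong:
  fixes f g :: "real \<Rightarrow> real"
  assumes "open S" "\<And>x. x \<in> S \<Longrightarrow> f x = g x" "x \<in> S"
  shows "(deriv ^^ k) f x = (deriv ^^ k) g x"
  using assms(3)
proof (induction k arbitrary: x)
  case 0
  then show ?case using assms by simp
next
  case (Suc k)
  have "\<forall>\<^sub>F y in nhds x. (deriv ^^ k) f y = (deriv ^^ k) g y"
    using Suc assms(1) eventually_nhds by blast
  then show ?case by (simp add: deriv_cong_ev)
qed

text \<open>\<open>deriv\<close> has an arbitrary value where no derivative exists, and that value
  need not scale with \<open>c\<close>. Hence differentiability is required at every order below
  \<open>k\<close>, on an open set so that each order can be differentiated again.\<close>

lemma funpow_deriv_cmult: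
  fixes f :: "real \<Rightarrow> real"
  assumes "open S" "\<And>j x. j < k \<Longrightarrow> x \<in> S \<Longrightarrow> (deriv ^^ j) f differentiable at x" "x \<in> S"
  shows "(deriv ^^ k) (\<lambda>s. c * f s) x = c * (deriv ^^ k) f x"
  using assms(2,3)
proof (induction k arbitrary: x)
  case 0
  then show ?case by simp
next
  case (Suc k)
  have "\<forall>\<^sub>F y in nhds x. (deriv ^^ k) (\<lambda>s. c * f s) y = c * (deriv ^^ k) f y"
    unfolding eventually_nhds
  proof (intro exI conjI ballI)
    show "(deriv ^^ k) (\<lambda>s. c * f s) y = c * (deriv ^^ k) f y" if "y \<in> S" for y
      using Suc.prems(1) that by (intro Suc.IH) auto
  qed (use Suc.prems assms(1) in auto)
  then have "deriv ((deriv ^^ k) (\<lambda>s. c * f s)) x = deriv (\<lambda>y. c * (deriv ^^ k) f y) x"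
    by (rule deriv_cong_ev) simp
  also have "\<dots> = c * deriv ((deriv ^^ k) f) x"
    using Suc.prems
    by (intro deriv_cmult) (auto simp: field_differentiable_def real_differentiable_def)
  finally show ?case by simp
qed

lemma funpow_partial_x: "(partial_x ^^ k) u (x, y) = (deriv ^^ k) (\<lambda>s. u (s, y)) x"
proof (induction k arbitrary: x)
  case (Suc k)
  then show ?case by (simp add: partial_x_def)
qed simp

lemma funpow_partial_y: "(partial_y ^^ k) u (x, y) = (deriv ^^ k) (\<lambda>t. u (x, t)) y"
proof (induction k arbitrary: y)
  case (Suc k)
  then show ?case by (simp add: partial_y_def)
qed simp

section \<open>Classes C^k and slices\<close>

lemma Ck_on_cong:
  assumes "Ck_on k S u" "\<And>p. p \<in> S \<Longrightarrow> u p = v p"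
  shows "Ck_on k S v"
proof (cases k)
  case 0
  then show ?thesis using assms by (metis Ck_on.simps(1) continuous_on_cong)
next
  case (Suc j)
  have "(v has_derivative d) (at p within S)"
    if "(u has_derivative d) (at p within S)" "p \<in> S" for d p
    using has_derivative_transform[OF that(2) _ that(1)] assms(2) by metis
  then show ?thesis using assms(1) unfolding Suc Ck_on.simps by blast
qed

text \<open>Chain rule along a horizontal line. Keeping \<open>X\<close> and \<open>S\<close>
  general serves both open boxes and the closed square, where the derivative at an endpoint is
  one-sided.\<close>

lemma slice_x_derivative:
  assumes "(u has_derivative (\<lambda>h. a * fst h + b * snd h)) (at (x, y) within S)"
    "X \<times> {y} \<subseteq> S"
  shows "((\<lambda>s. u (s, y)) has_real_derivative a) (at x within X)"
proof -
  have "((\<lambda>s. (s, y)) has_derivative (\<lambda>h. (h, 0))) (at x within X)"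
    by (auto intro!: derivative_eq_intros)
  moreover have "(u has_derivative (\<lambda>h. a * fst h + b * snd h))
      (at (x, y) within (\<lambda>s. (s, y)) ` X)"
    by (rule has_derivative_subset[OF assms(1)]) (use assms(2) in auto)
  ultimately have "((\<lambda>s. u (s, y)) has_derivative (\<lambda>h. a * h)) (at x within X)"
    by (auto dest: has_derivative_in_compose)
  then show ?thesis by (simp add: has_field_derivative_def)
qed

lemma slice_y_derivative:
  assumes "(u has_derivative (\<lambda>h. a * fst h + b * snd h)) (at (x, y) within S)"
    "{x} \<times> Y \<subseteq> S"
  shows "((\<lambda>t. u (x, t)) has_real_derivative b) (at y within Y)"
proof -
  have "((\<lambda>t. (x, t)) has_derivative (\<lambda>h. (0, h))) (at y within Y)"
    by (auto intro!: derivative_eq_intros)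
  moreover have "(u has_derivative (\<lambda>h. a * fst h + b * snd h))
      (at (x, y) within (\<lambda>t. (x, t)) ` Y)"
    by (rule has_derivative_subset[OF assms(1)]) (use assms(2) in auto)
  ultimately have "((\<lambda>t. u (x, t)) has_derivative (\<lambda>h. b * h)) (at y within Y)"
    by (auto dest: has_derivative_in_compose)
  then show ?thesis by (simp add: has_field_derivative_def)
qed

lemma slice_derivatives_open_box:
  assumes "open X" "open Y" "x \<in> X" "y \<in> Y"
    "(u has_derivative (\<lambda>h. a * fst h + b * snd h)) (at (x, y) within X \<times> Y)"
  shows "((\<lambda>s. u (s, y)) has_real_derivative a) (at x)"
    and "((\<lambda>t. u (x, t)) has_real_derivative b) (at y)"
  using slice_x_derivative[OF assms(5), of X] slice_y_derivative[OF assms(5), of Y] assms(1-4)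
  by (auto simp: at_within_open[of _ X] at_within_open[of _ Y])

text \<open>\<open>Ck_on\<close> only asserts that some \<open>ux\<close> and \<open>uy\<close>
  exist. On an open box, uniqueness of derivatives along slices identifies them with the partials
  built from \<open>deriv\<close>, in which the bilaplacian is written.\<close>

lemma Ck_on_partials:
  assumes "open X" "open Y" "Ck_on (Suc k) (X \<times> Y) u"
  shows "Ck_on k (X \<times> Y) (partial_x u)" "Ck_on k (X \<times> Y) (partial_y u)"
proof -
  obtain ux uy where k: "Ck_on k (X \<times> Y) ux" "Ck_on k (X \<times> Y) uy"
    and d: "\<And>p. p \<in> X \<times> Y \<Longrightarrow>
      (u has_derivative (\<lambda>h. ux p * fst h + uy p * snd h)) (at p within X \<times> Y)"
    using assms(3) by auto
  have "ux p = partial_x u p \<and> uy p = partial_y u p" if p: "p \<in> X \<times> Y" for p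
    using slice_derivatives_open_box[OF assms(1,2), of "fst p" "snd p" u "ux p" "uy p"] d[OF p] p
    by (auto simp: partial_x_def partial_y_def DERIV_imp_deriv)
  then show "Ck_on k (X \<times> Y) (partial_x u)" "Ck_on k (X \<times> Y) (partial_y u)"
    using Ck_on_cong[OF k(1)] Ck_on_cong[OF k(2)] by metis+
qed

lemma Ck_on_funpow_partials:
  assumes "open X" "open Y" "Ck_on (j + k) (X \<times> Y) u"
  shows "Ck_on k (X \<times> Y) ((partial_x ^^ j) u)" "Ck_on k (X \<times> Y) ((partial_y ^^ j) u)"
proof -
  have "Ck_on k (X \<times> Y) ((partial_x ^^ j) u) \<and> Ck_on k (X \<times> Y) ((partial_y ^^ j) u)"
    using assms(3)
  proof (induction j arbitrary: k)
    case (Suc j)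
    then have "Ck_on (j + Suc k) (X \<times> Y) u" by simp
    from Suc.IH[OF this] show ?case
      by (simp del: Ck_on.simps add: Ck_on_partials[OF assms(1,2)])
  qed simp
  then show "Ck_on k (X \<times> Y) ((partial_x ^^ j) u)" "Ck_on k (X \<times> Y) ((partial_y ^^ j) u)"
    by blast+
qed

lemma Ck_on_slices_differentiable:
  assumes "open X" "open Y" "Ck_on k (X \<times> Y) u" "j < k" "x \<in> X" "y \<in> Y"
  shows "(deriv ^^ j) (\<lambda>s. u (s, y)) differentiable at x"
    and "(deriv ^^ j) (\<lambda>t. u (x, t)) differentiable at y"
proof -
  \<comment> \<open>Writing \<open>k\<close> this way leaves the pure partial of order
    \<open>j\<close> at least one order of differentiability, because \<open>j < k\<close>.\<close>
  have "Ck_on (j + Suc (k - j - 1)) (X \<times> Y) u" using assms by simp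
  note C = Ck_on_funpow_partials[OF assms(1,2) this]
  from C(1) obtain a b where
    "((partial_x ^^ j) u has_derivative (\<lambda>h. a * fst h + b * snd h)) (at (x, y) within X \<times> Y)"
    using assms by force
  from slice_derivatives_open_box(1)[OF assms(1,2,5,6) this]
  show "(deriv ^^ j) (\<lambda>s. u (s, y)) differentiable at x"
    by (auto simp: funpow_partial_x real_differentiable_def)
  from C(2) obtain a b where
    "((partial_y ^^ j) u has_derivative (\<lambda>h. a * fst h + b * snd h)) (at (x, y) within X \<times> Y)"
    using assms by force
  from slice_derivatives_open_box(2)[OF assms(1,2,5,6) this]
  show "(deriv ^^ j) (\<lambda>t. u (x, t)) differentiable at y"
    by (auto simp: funpow_partial_y real_differentiable_def)
qed

text \<open>\<open>D\<close> stands for the derivative within the closed interval, continuous up to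
  the endpoints. It replaces \<open>deriv f\<close>, which is two-sided and so says nothing about
  the one-sided derivative at \<open>1\<close>; the two agree in the open interval.\<close>

lemma clamped_slice_zero:
  fixes f D :: "real \<Rightarrow> real"
  assumes f: "\<And>x. x \<in> {-1..1} \<Longrightarrow> (f has_real_derivative D x) (at x within {-1..1})"
    and cD: "continuous_on {-1..1} D"
    and f1: "f 1 = 0" and n: "((\<lambda>t. f (1 + t)) has_real_derivative 0) (at 0 within {..0})"
    and diff: "\<And>x. x \<in> {-1<..<1} \<Longrightarrow> deriv f differentiable at x"
    and eq: "\<And>x. x \<in> {-1<..<1} \<Longrightarrow> (deriv ^^ 2) f x = c * f x"
    and x: "x \<in> {-1..1}"
  shows "f x = 0"
proof (rule linear_second_order_zero[where f = f and x = x and c = c, OF _ cD])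
  show "continuous_on {-1..1} f"
    using f by (meson DERIV_continuous_on)
  have f': "(f has_real_derivative D x) (at x)" if "x \<in> {-1<..<1}" for x
    using f[of x] that at_within_Icc_at[of "-1" x 1] by auto
  then show "(f has_real_derivative D x) (at x)" if "-1 < x" "x < 1" for x
    using that by auto
  show "(D has_real_derivative c * f x) (at x)" if "-1 < x" "x < 1" for x
  proof (rule has_field_derivative_transform_within_open)
    show "(deriv f has_real_derivative c * f x) (at x)"
      using diff[of x] eq[of x] that
      by (auto simp: eval_nat_numeral real_differentiable_def DERIV_imp_deriv)
    show "deriv f y = D y" if "y \<in> {-1<..<1}" for y
      using f'[OF that] by (rule DERIV_imp_deriv)
  qed (use that in auto)
  \<comment> \<open>Both one-sided derivatives at the endpoint, \<open>D 1\<close> and the normal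
    derivative \<open>0\<close>, are brought to the common domain \<open>{-2..0}\<close>, where
    derivatives at \<open>0\<close> are unique.\<close>
  have "((\<lambda>t. f (1 + t)) has_real_derivative D 1) (at 0 within {-2..0})"
  proof -
    have "(+) 1 ` {-2..0::real} = {-1..1}" by simp
    then show ?thesis
      using f[of 1] DERIV_at_within_shift[of f "D 1" 1 0 "{-2..0}"] by simp
  qed
  moreover have "((\<lambda>t. f (1 + t)) has_real_derivative 0) (at 0 within {-2..0})"
    by (rule has_field_derivative_subset[OF n]) auto
  moreover have "at (0::real) within {-2..0} \<noteq> bot"
    by (simp add: trivial_limit_within islimpt_Icc)
  ultimately show "D 1 = 0"
    by (metis has_field_derivative_unique)
qed (use f1 x in auto)

section \<open>Separation of variables on the square\<close>

lemma interior_square: "interior square = {-1<..<1} \<times> {-1<..<1}"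
  by (simp add: square_def interior_Times)

lemma frontier_square: "p \<in> frontier square \<longleftrightarrow> p \<in> square \<and> p \<notin> interior square"
proof -
  have "closed square" by (simp add: square_def closed_Times)
  then show ?thesis by (simp add: frontier_def)
qed

theorem theorem4p3:
  "\<not> (\<exists>(\<mu>::real) (u :: real \<times> real \<Rightarrow> real).
        clamped_plate_solution \<mu> u \<and> (\<exists>p\<in>square. u p \<noteq> 0) \<and> separable_on_square u)"
proof (intro notI, elim exE conjE bexE)
  fix \<mu> u p
  assume sol: "clamped_plate_solution \<mu> u" and p: "p \<in> square" "u p \<noteq> 0"
    and sep: "separable_on_square u"
  let ?I = "{-1<..<1::real}"
  have C4: "Ck_on 4 (?I \<times> ?I) u" and C1: "Ck_on 1 square u"
    and pde: "\<And>x y. x \<in> ?I \<Longrightarrow> y \<in> ?I \<Longrightarrow> bilaplacian u (x, y) = \<mu> * u (x, y)"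
    and bd: "\<And>q. q \<in> frontier square \<Longrightarrow> u q = 0"
    and nd: "\<And>q \<nu>. exterior_unit_normal q \<nu> \<Longrightarrow> has_normal_derivative u 0 q \<nu>"
    using sol by (auto simp: clamped_plate_solution_def interior_square)
  obtain a b where ab: "p = (a, b)" by (cases p)
  \<comment> \<open>The boundary values are zero, so a point where \<open>u\<close> does not vanish
    is interior.\<close>
  have a: "a \<in> ?I" and b: "b \<in> ?I"
    using p bd[of p] frontier_square[of p] by (auto simp: ab interior_square)
  \<comment> \<open>No regularity is known for the given factors, but slices of \<open>u\<close>
    inherit it. Dividing by \<open>u (a, b)\<close> makes the product of the two slices equal to
    \<open>u\<close>, since the surplus factor is \<open>\<alpha> a * \<beta> b\<close>.\<close>
  define f where "f = (\<lambda>x. u (x, b))"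
  define g where "g = (\<lambda>y. u (a, y) / u (a, b))"
  have fa: "f a \<noteq> 0" and gb: "g b = 1" using p ab by (auto simp: f_def g_def)
  have u: "u (x, y) = f x * g y" if "x \<in> {-1..1}" "y \<in> {-1..1}" for x y
  proof -
    obtain \<alpha> \<beta> :: "real \<Rightarrow> real" where
      "\<forall>x\<in>{-1..1}. \<forall>y\<in>{-1..1}. u (x, y) = \<alpha> x * \<beta> y"
      using sep unfolding separable_on_square_def by blast
    then show ?thesis using that a b fa by (auto simp: f_def g_def)
  qed
  have df: "(deriv ^^ j) f differentiable at x" if "j < 4" "x \<in> ?I" for j x
    unfolding f_def using Ck_on_slices_differentiable(1)[OF _ _ C4 that b] by simp
  have du: "(deriv ^^ j) (\<lambda>t. u (a, t)) differentiable at y" if "j < 4" "y \<in> ?I" for j y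
    using Ck_on_slices_differentiable(2)[OF _ _ C4 that(1) a that(2)] by simp
  have gu: "(deriv ^^ j) g y = inverse (u (a, b)) * (deriv ^^ j) (\<lambda>t. u (a, t)) y"
    if "j \<le> 4" "y \<in> ?I" for j y
    using funpow_deriv_cmult[of ?I j "\<lambda>t. u (a, t)" y "inverse (u (a, b))"] du that
    by (simp add: g_def divide_inverse mult.commute)
  have dg: "(deriv ^^ j) g differentiable at y" if jy: "j < 4" "y \<in> ?I" for j y
  proof -
    obtain d where "((deriv ^^ j) (\<lambda>t. u (a, t)) has_real_derivative d) (at y)"
      using du[OF jy] by (auto simp: real_differentiable_def)
    from DERIV_cmult[OF this, of "inverse (u (a, b))"]
    have "((deriv ^^ j) g has_real_derivative inverse (u (a, b)) * d) (at y)"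
      by (rule has_field_derivative_transform_within_open[where S = ?I])
        (use jy gu in auto)
    then show ?thesis by (auto simp: real_differentiable_def)
  qed
  have ux: "(deriv ^^ k) (\<lambda>s. u (s, y)) x = g y * (deriv ^^ k) f x"
    if "k \<le> 4" "x \<in> ?I" "y \<in> ?I" for k x y
  proof -
    have "(deriv ^^ k) (\<lambda>s. u (s, y)) x = (deriv ^^ k) (\<lambda>s. g y * f s) x"
      by (rule funpow_deriv_cong[of ?I]) (use that u in auto)
    also have "\<dots> = g y * (deriv ^^ k) f x"
      by (rule funpow_deriv_cmult[of ?I]) (use that df in auto)
    finally show ?thesis .
  qed
  have uy: "(deriv ^^ k) (\<lambda>t. u (x, t)) y = f x * (deriv ^^ k) g y"
    if "k \<le> 4" "x \<in> ?I" "y \<in> ?I" for k x y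
  proof -
    have "(deriv ^^ k) (\<lambda>t. u (x, t)) y = (deriv ^^ k) (\<lambda>t. f x * g t) y"
      by (rule funpow_deriv_cong[of ?I]) (use that u in auto)
    also have "\<dots> = f x * (deriv ^^ k) g y"
      by (rule funpow_deriv_cmult[of ?I]) (use that dg in auto)
    finally show ?thesis .
  qed
  \<comment> \<open>For fixed \<open>y\<close>, the inner second derivative is
    \<open>(deriv ^^ 2) g y * f s\<close> as a function of \<open>s\<close>, so the outer
    derivatives fall on \<open>f\<close> alone.\<close>
  have uxy: "(deriv ^^ 2) (\<lambda>s. (deriv ^^ 2) (\<lambda>t. u (s, t)) y) x = (deriv ^^ 2) g y * (deriv ^^ 2) f x"
    if "x \<in> ?I" "y \<in> ?I" for x y
  proof -
    have "(deriv ^^ 2) (\<lambda>s. (deriv ^^ 2) (\<lambda>t. u (s, t)) y) x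
        = (deriv ^^ 2) (\<lambda>s. (deriv ^^ 2) g y * f s) x"
      by (rule funpow_deriv_cong[of ?I]) (use that uy[of 2] in auto)
    also have "\<dots> = (deriv ^^ 2) g y * (deriv ^^ 2) f x"
      by (rule funpow_deriv_cmult[of ?I]) (use that df in auto)
    finally show ?thesis .
  qed
  have ode: "(deriv ^^ 4) f x * g y + 2 * (deriv ^^ 2) f x * (deriv ^^ 2) g y
      + f x * (deriv ^^ 4) g y = \<mu> * f x * g y" if "x \<in> ?I" "y \<in> ?I" for x y
    using pde[OF that] that ux[of 4 x y] uy[of 4 x y] uxy[of x y] u[of x y]
    unfolding bilaplacian_def funpow_partial_x funpow_partial_y
    by (simp add: algebra_simps)

  obtain vx vy where cv: "continuous_on square vx" "continuous_on square vy"
    and v: "\<And>q. q \<in> square \<Longrightarrow>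
      (u has_derivative (\<lambda>h. vx q * fst h + vy q * snd h)) (at q within square)"
    using C1 by auto
  \<comment> \<open>Otherwise \<open>f\<close> solves a second-order equation with zero Cauchy data
    on the right edge, so it vanishes, contrary to \<open>f a \<noteq> 0\<close>.\<close>
  have fne: "\<exists>x\<in>?I. (deriv ^^ 2) f x \<noteq> k * f x" for k
  proof (rule ccontr)
    assume "\<not> ?thesis"
    then have eq: "\<And>x. x \<in> ?I \<Longrightarrow> (deriv ^^ 2) f x = k * f x" by auto
    have "f a = 0"
    proof (rule clamped_slice_zero[where f = f, OF _ _ _ _ _ eq])
      show "(f has_real_derivative vx (x, b)) (at x within {-1..1})" if "x \<in> {-1..1}" for x
        unfolding f_def by (rule slice_x_derivative[OF v]) (use that b in \<open>auto simp: square_def\<close>)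
      show "continuous_on {-1..1} (\<lambda>x. vx (x, b))"
        by (rule continuous_on_compose2[OF cv(1)])
          (use b in \<open>auto simp: square_def intro!: continuous_intros\<close>)
      show "f 1 = 0"
        unfolding f_def using b
        by (intro bd) (auto simp: frontier_square interior_square, auto simp: square_def)
      have "exterior_unit_normal (1, b) (1, 0)"
        using b by (auto simp: exterior_unit_normal_def)
      from nd[OF this]
      show "((\<lambda>t. f (1 + t)) has_real_derivative 0) (at 0 within {..0})"
        by (simp add: has_normal_derivative_def f_def)
      show "deriv f differentiable at x" if "x \<in> ?I" for x
        using df[of 1 x] that by simp
    qed (use a in auto)
    with fa show False by simp
  qed
  \<comment> \<open>The same argument at the top edge, applied to the unnormalised slice
    \<open>u (a, t)\<close> so that the boundary conditions on \<open>u\<close> apply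
    directly.\<close>
  have gne: "\<exists>y\<in>?I. (deriv ^^ 2) g y \<noteq> k * g y" for k
  proof (rule ccontr)
    assume "\<not> ?thesis"
    then have eq: "\<And>y. y \<in> ?I \<Longrightarrow> (deriv ^^ 2) g y = k * g y" by auto
    have "u (a, b) = 0"
    proof (rule clamped_slice_zero[where f = "\<lambda>t. u (a, t)"])
      show "((\<lambda>t. u (a, t)) has_real_derivative vy (a, y)) (at y within {-1..1})"
        if "y \<in> {-1..1}" for y
        by (rule slice_y_derivative[OF v]) (use that a in \<open>auto simp: square_def\<close>)
      show "continuous_on {-1..1} (\<lambda>y. vy (a, y))"
        by (rule continuous_on_compose2[OF cv(2)])
          (use a in \<open>auto simp: square_def intro!: continuous_intros\<close>)
      show "u (a, 1) = 0"
        using a by (intro bd) (auto simp: frontier_square interior_square, auto simp: square_def)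
      have "exterior_unit_normal (a, 1) (0, 1)"
        using a by (auto simp: exterior_unit_normal_def)
      from nd[OF this]
      show "((\<lambda>t. u (a, 1 + t)) has_real_derivative 0) (at 0 within {..0})"
        by (simp add: has_normal_derivative_def)
      show "deriv (\<lambda>t. u (a, t)) differentiable at y" if "y \<in> ?I" for y
        using du[of 1 y] that by simp
      show "(deriv ^^ 2) (\<lambda>t. u (a, t)) y = k * u (a, y)" if "y \<in> ?I" for y
        using uy[of 2 a y] eq[of y] u[of a y] that a by simp
    qed (use b in auto)
    with p ab show False by simp
  qed

  \<comment> \<open>The ratio at \<open>a\<close> is the only candidate for a constant
    \<open>k\<close> with \<open>f'' = k f\<close>; \<open>x\<close> is a point where it fails,
    which gives \<open>w \<noteq> 0\<close>.\<close>
  obtain x where x: "x \<in> ?I" and ne: "(deriv ^^ 2) f x \<noteq> (deriv ^^ 2) f a / f a * f x"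
    using fne by blast
  define w where "w = 2 * ((deriv ^^ 2) f x * f a - (deriv ^^ 2) f a * f x)"
  define z where "z = (deriv ^^ 4) f a * f x - (deriv ^^ 4) f x * f a"
  have "w \<noteq> 0" using ne fa by (simp add: w_def field_simps)
  have "(deriv ^^ 2) g y = z / w * g y" if y: "y \<in> ?I" for y
  proof -
    \<comment> \<open>Multiply the equation at \<open>x\<close> by \<open>f a\<close>, the one at
      \<open>a\<close> by \<open>f x\<close>, and subtract: the terms with
      \<open>(deriv ^^ 4) g y\<close> and with \<open>\<mu>\<close> cancel.\<close>
    have "w * (deriv ^^ 2) g y = z * g y"
      using ode[OF x y] ode[OF a y] unfolding w_def z_def by algebra
    with \<open>w \<noteq> 0\<close> show ?thesis by (simp add: field_simps)
  qed
  with gne show False by blast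
qed

end
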